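(* For integers $m\ge n\ge 2$, $$ub(K_{m,n})\ge \frac{n}{2(m+n)}\,m+\frac{2}{m+n}.$$ Consequently, if $n=m-o(m)$, then $ub(K_{m,n})\ge \frac m4+o(m)$.
   Context: $K_{m,n}$ is the complete bipartite graph with parts of sizes $m$ and $n$. A bar is a closed horizontal line segment of length $1$ in the plane. Two bars of an arrangement of pairwise disjoint bars see each other if there is an axis-parallel rectangle of positive width whose bottom side lies in one of them, whose top side lies in the other, and whose interior meets no bar of the arrangement. For a nonnegative integer $t$, a $t$-unit-bar visibility representation of a graph $G$ assigns to each vertex a set of at most $t$ bars, all bars pairwise disjoint, such that two distinct vertices are adjacent iff some bar of one sees some bar of the other; $ub(G)$ is the minimum such $t$. *)

theory Defs
  imports Complex_Main "HOL-Library.Landau_Symbols" "Graph_Theory.Kuratowski"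
begin

definition unit_bar :: "(real \<times> real) set \<Rightarrow> bool" where
  "unit_bar B \<longleftrightarrow> (\<exists>x y. B = {x..x + 1} \<times> {y})"

text \<open>
  The rectangle is \<open>[a, b] \<times> [c, d]\<close>; its interior must miss the whole arrangement \<open>\<A>\<close>,
  that is, every bar in it.
\<close>

definition sees_from_below ::
  "(real \<times> real) set set \<Rightarrow> (real \<times> real) set \<Rightarrow> (real \<times> real) set \<Rightarrow> bool" where
  "sees_from_below \<A> B C \<longleftrightarrow>
     (\<exists>a b c d. a < b \<and> c < d \<and> {a..b} \<times> {c} \<subseteq> B \<and> {a..b} \<times> {d} \<subseteq> C \<and>
        (\<forall>D\<in>\<A>. ({a<..<b} \<times> {c<..<d}) \<inter> D = {}))"

definition see_each_other ::
  "(real \<times> real) set set \<Rightarrow> (real \<times> real) set \<Rightarrow> (real \<times> real) set \<Rightarrow> bool" where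
  "see_each_other \<A> B C \<longleftrightarrow> sees_from_below \<A> B C \<or> sees_from_below \<A> C B"

text \<open>
  Undirected graphs are symmetric loop-free digraphs, as in \<^locale>\<open>graph\<close>, and adjacency is
  \<open>u \<rightarrow>\<^bsub>G\<^esub> v\<close>. A vertex may receive no bar, and a bar belongs to at most one vertex.
\<close>

definition unit_bar_visibility_rep ::
  "nat \<Rightarrow> ('a, 'b) pre_digraph \<Rightarrow> ('a \<Rightarrow> (real \<times> real) set set) \<Rightarrow> bool" where
  "unit_bar_visibility_rep t G f \<longleftrightarrow>
     (\<forall>v\<in>verts G. finite (f v) \<and> card (f v) \<le> t \<and> (\<forall>B\<in>f v. unit_bar B)) \<and>
     (\<forall>u\<in>verts G. \<forall>v\<in>verts G. \<forall>B\<in>f u. \<forall>C\<in>f v. u \<noteq> v \<or> B \<noteq> C \<longrightarrow> B \<inter> C = {}) \<and>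
     (\<forall>u\<in>verts G. \<forall>v\<in>verts G. u \<noteq> v \<longrightarrow>
        (u \<rightarrow>\<^bsub>G\<^esub> v \<longleftrightarrow> (\<exists>B\<in>f u. \<exists>C\<in>f v. see_each_other (\<Union>w\<in>verts G. f w) B C)))"

text \<open>
  Every finite graph has such a representation for some \<open>t\<close> (two stacked bars for each edge, with
  the pairs far apart horizontally), so \<open>LEAST\<close> is the true minimum.
\<close>

definition unit_bar_visibility_number :: "('a, 'b) pre_digraph \<Rightarrow> nat" (\<open>ub\<close>) where
  "ub G = (LEAST t. \<exists>f. unit_bar_visibility_rep t G f)"

end

theory Submission
  imports Defs "HOL-Library.Product_Lexorder"
begin

text \<open>
  Let \<open>N\<close> bars be given, each in one of two colors. The number \<open>E\<close> of visible pairs of different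
  colors is at most \<open>2 N - 4\<close>, the edge bound of bipartite planar graphs. In place of Euler's formula
  the proof sweeps a vertical line over the bars and follows the set of bicolored pairs of
  vertically consecutive bars on the line. Every visible pair enters and leaves this set, and each of
  the \<open>2 N\<close> bar ends changes the set in at most two pairs, whence \<open>2 E \<le> 4 N\<close>; the ends at which the
  bar concerned is topmost or bottommost improve this. A representation of \<open>K\<^bsub>m,n\<^esub>\<close> with at most \<open>t\<close> bars
  per vertex has \<open>N \<le> t (m + n)\<close> and \<open>E \<ge> m n\<close>, and therefore \<open>m n + 4 \<le> 2 t (m + n)\<close>.
\<close>

section \<open>Bicolored pairs of vertical neighbours and their changes\<close>

text \<open>\<open>T\<close> stands for the bars met by the sweep line, \<open>y\<close> for their
  heights and \<open>c\<close> for the two colors. A pair lists its lower bar first, so that it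
  occurs only once.\<close>

definition bicolored_neighbours ::
  "('a \<Rightarrow> 'q::linorder) \<Rightarrow> ('a \<Rightarrow> bool) \<Rightarrow> 'a set \<Rightarrow> ('a \<times> 'a) set" where
  "bicolored_neighbours y c T =
     {(u, v). u \<in> T \<and> v \<in> T \<and> y u < y v \<and> c u \<noteq> c v \<and> \<not> (\<exists>w\<in>T. y u < y w \<and> y w < y v)}"

lemma bicolored_neighbours_empty [simp]: "bicolored_neighbours y c {} = {}"
  by (simp add: bicolored_neighbours_def)

lemma bicolored_neighbours_subset: "bicolored_neighbours y c T \<subseteq> T \<times> T"
  by (auto simp: bicolored_neighbours_def)

lemma finite_bicolored_neighbours: "finite T \<Longrightarrow> finite (bicolored_neighbours y c T)"
  by (rule finite_subset[OF bicolored_neighbours_subset]) simp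

text \<open>Since \<open>F\<close> starts empty, each element of the union enters at some event and
  then either leaves at another event or survives in \<open>F Q\<close>. Hence the right-hand side
  counts it at least twice. The induction splits off the last event.\<close>

lemma card_le_sum_sym_diff:
  fixes Q :: "'p::linorder set" and F :: "'p set \<Rightarrow> 'e set"
  assumes "finite Q" and "F {} = {}" and "\<And>R. finite (F R)"
  shows "2 * card (\<Union>t. F {q\<in>Q. q \<le> t})
    \<le> (\<Sum>p\<in>Q. card (sym_diff (F {q\<in>Q. q < p}) (F {q\<in>Q. q \<le> p})))
       + card (F Q)"
  using assms(1)
proof (induction Q rule: finite_linorder_max_induct)
  case empty
  then show ?case by (simp add: assms(2))
next
  case (insert b Q)
  let ?U = "\<Union>t. F {q\<in>Q. q \<le> t}"
  let ?G = "F (insert b Q)"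
  let ?D = "\<lambda>Q p. card (sym_diff (F {q\<in>Q. q < p}) (F {q\<in>Q. q \<le> p}))"
  have fin: "finite ?U"
  proof (rule finite_subset)
    show "?U \<subseteq> (\<Union>R\<in>Pow Q. F R)"
      by (intro UN_least UN_upper) simp
    show "finite (\<Union>R\<in>Pow Q. F R)"
      using insert.hyps(1) by (intro finite_UN_I assms(3)) simp
  qed
  have "F {q \<in> insert b Q. q \<le> t} \<subseteq> ?U \<union> ?G" for t
  proof (cases "b \<le> t")
    case True
    then have "{q \<in> insert b Q. q \<le> t} = insert b Q"
      using insert.hyps(2) by fastforce
    then show ?thesis by simp
  next
    case False
    then have "{q \<in> insert b Q. q \<le> t} = {q \<in> Q. q \<le> t}"
      by auto
    then show ?thesis by auto
  qed
  then have sub: "(\<Union>t. F {q \<in> insert b Q. q \<le> t}) \<subseteq> ?U \<union> ?G" by blast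
  have FQ: "F Q \<subseteq> ?U"
  proof (cases "Q = {}")
    case False
    then have "{q \<in> Q. q \<le> Max Q} = Q" using insert.hyps by auto
    then have "F Q = F {q \<in> Q. q \<le> Max Q}" by simp
    then show ?thesis by blast
  qed (simp add: assms(2))
  have "card (\<Union>t. F {q \<in> insert b Q. q \<le> t}) \<le> card (?U \<union> ?G)"
    using sub by (rule card_mono[rotated]) (simp add: fin assms(3))
  also have "?U \<union> ?G = ?U \<union> (?G - ?U)" by blast
  also have "card \<dots> \<le> card ?U + card (?G - ?U)" by (rule card_Un_le)
  also have "card (?G - ?U) \<le> card (?G - F Q)"
    using FQ assms(3) by (intro card_mono) auto
  finally have 1: "card (\<Union>t. F {q \<in> insert b Q. q \<le> t}) \<le> card ?U + card (?G - F Q)"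
    by simp
  have old: "?D (insert b Q) p = ?D Q p" if "p \<in> Q" for p
  proof -
    have "{q \<in> insert b Q. q < p} = {q \<in> Q. q < p}" "{q \<in> insert b Q. q \<le> p} = {q \<in> Q. q \<le> p}"
      using insert.hyps(2) that by auto
    then show ?thesis by simp
  qed
  have "{q \<in> insert b Q. q < b} = Q" "{q \<in> insert b Q. q \<le> b} = insert b Q"
    using insert.hyps(2) by auto
  then have "?D (insert b Q) b = card (F Q - ?G \<union> (?G - F Q))" by simp
  also have "\<dots> = card (F Q - ?G) + card (?G - F Q)"
    using assms(3) by (intro card_Un_disjoint) auto
  finally have 2: "?D (insert b Q) b = card (F Q - ?G) + card (?G - F Q)" .
  \<comment> \<open>Both sides count \<open>F Q \<union> ?G\<close>; this trades the old final set
    for the new one.\<close>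
  have 3: "card (F Q) + card (?G - F Q) = card ?G + card (F Q - ?G)"
  proof -
    have "card (F Q) = card (F Q \<inter> ?G) + card (F Q - ?G)"
      "card ?G = card (F Q \<inter> ?G) + card (?G - F Q)"
      using card_Int_Diff[of "F Q" ?G] card_Int_Diff[of ?G "F Q"] assms(3)
      by (simp_all add: Int_commute)
    then show ?thesis by simp
  qed
  have "(\<Sum>p\<in>insert b Q. ?D (insert b Q) p) = ?D (insert b Q) b + (\<Sum>p\<in>Q. ?D Q p)"
    using insert.hyps old by (subst sum.insert) auto
  then show ?case using 1 2 3 insert.IH by linarith
qed

text \<open>
  Only \<open>d\<close>, its predecessor and its successor are concerned, and two colors leave at most two
  bicolored pairs among three elements.
\<close>

lemma bicolored_neighbours_toggle:
  fixes y :: "'a \<Rightarrow> 'q::linorder" and c :: "'a \<Rightarrow> bool"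
  assumes "inj_on y T" and "d \<in> T"
  defines "P \<equiv> {u\<in>T. y u < y d \<and> \<not> (\<exists>w\<in>T. y u < y w \<and> y w < y d)}"
    and "S \<equiv> {v\<in>T. y d < y v \<and> \<not> (\<exists>w\<in>T. y d < y w \<and> y w < y v)}"
    and "D \<equiv> sym_diff (bicolored_neighbours y c T) (bicolored_neighbours y c (T - {d}))"
  shows "card D \<le> 2"
    and "(\<forall>w\<in>T. y d \<le> y w) \<or> (\<forall>w\<in>T. y w \<le> y d) \<Longrightarrow> card D \<le> 1"
    and "T = {d} \<Longrightarrow> card D = 0"
proof -
  have P: "P = {} \<or> (\<exists>u. P = {u})"
  proof -
    have "u = u'" if "u \<in> P" "u' \<in> P" for u u'
      using that inj_onD[OF assms(1), of u u'] linorder_less_linear[of "y u" "y u'"]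
      by (auto simp: P_def)
    then show ?thesis by blast
  qed
  have S: "S = {} \<or> (\<exists>u. S = {u})"
  proof -
    have "u = u'" if "u \<in> S" "u' \<in> S" for u u'
      using that inj_onD[OF assms(1), of u u'] linorder_less_linear[of "y u" "y u'"]
      by (auto simp: S_def)
    then show ?thesis by blast
  qed
  have col: "c u \<noteq> c v" if "(u, v) \<in> D" for u v
    using that by (auto simp: D_def bicolored_neighbours_def)
  \<comment> \<open>Pairs lost on deleting \<open>d\<close> contain \<open>d\<close>; a pair gained
    by the deletion closes the gap between the two neighbours of \<open>d\<close>.\<close>
  have sub: "D \<subseteq> P \<times> {d} \<union> {d} \<times> S \<union> P \<times> S"
  proof
    fix e assume "e \<in> D"
    then obtain u v where e: "e = (u, v)" and uv: "(u, v) \<in> D" by (cases e) auto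
    consider "(u, v) \<in> bicolored_neighbours y c T" "(u, v) \<notin> bicolored_neighbours y c (T - {d})"
      | "(u, v) \<in> bicolored_neighbours y c (T - {d})" "(u, v) \<notin> bicolored_neighbours y c T"
      using uv D_def by auto
    then have "(u, v) \<in> P \<times> {d} \<union> {d} \<times> S \<union> P \<times> S"
    proof cases
      case 1
      then have "u = d \<or> v = d" by (auto simp: bicolored_neighbours_def)
      then show ?thesis using 1(1) by (auto simp: bicolored_neighbours_def P_def S_def)
    next
      case 2
      then have "y u < y d \<and> y d < y v"
        by (auto simp: bicolored_neighbours_def)
      then have "u \<in> P" "v \<in> S" using 2(1)
        unfolding P_def S_def bicolored_neighbours_def
        by (auto dest: less_trans)
      then show ?thesis by simp
    qed
    then show "e \<in> P \<times> {d} \<union> {d} \<times> S \<union> P \<times> S" by (simp add: e)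
  qed
  \<comment> \<open>If a neighbour of \<open>d\<close> is missing, only the pair of \<open>d\<close>
    with the other neighbour remains as a candidate.\<close>
  have one: "card D \<le> 1" if "P = {} \<or> S = {}"
  proof -
    from that obtain x where "D \<subseteq> {x}"
    proof
      assume "P = {}"
      then show ?thesis using S sub that by (elim disjE exE) auto
    next
      assume "S = {}"
      then show ?thesis using P sub that by (elim disjE exE) auto
    qed
    then show ?thesis using card_mono[of "{x}" D] by simp
  qed
  show "card D \<le> 2"
  proof (cases "P = {} \<or> S = {}")
    case False
    then obtain u v where uv: "P = {u}" "S = {v}" using P S by auto
    then have "D \<subseteq> {(u, d), (d, v), (u, v)}" using sub by auto
    moreover have "(u, d) \<notin> D \<or> (d, v) \<notin> D \<or> (u, v) \<notin> D" using col by blast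
    ultimately have "D \<subseteq> {(u, d), (d, v)} \<or> D \<subseteq> {(u, d), (u, v)} \<or> D \<subseteq> {(d, v), (u, v)}"
      by blast
    then obtain a b where "D \<subseteq> {a, b}" by blast
    then have "card D \<le> card {a, b}" by (intro card_mono) auto
    also have "\<dots> \<le> 2" by (simp add: card_insert_if)
    finally show ?thesis .
  qed (use one in simp)
  show "card D \<le> 1" if "(\<forall>w\<in>T. y d \<le> y w) \<or> (\<forall>w\<in>T. y w \<le> y d)"
  proof (rule one)
    show "P = {} \<or> S = {}" using that by (auto simp: P_def S_def not_less)
  qed
  show "card D = 0" if "T = {d}"
  proof -
    have "P = {}" "S = {}" using that by (auto simp: P_def S_def)
    then show ?thesis using sub by simp
  qed
qed

section \<open>Sweep bound for bars of two colors\<close>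

text \<open>
  \<open>A\<close> is a set of bars, swept in the order of their ends \<open>l\<close> and \<open>r\<close>, at heights \<open>y\<close>. Each of the
  \<open>2 * card A\<close> events changes at most two bicolored pairs; the total is at least seven below
  \<open>4 * card A\<close>, which by parity suffices. The first insertion and the last removal save two each, the
  removal of the last bar but one saves one. If the first bar \<open>b\<close> is extreme in height when it is
  removed, then this removal and the second insertion save one each; otherwise the first bar
  inserted below \<open>b\<close> and the first one inserted above \<open>b\<close> do.
\<close>

lemma card_bicolored_neighbours_sweep:
  fixes A :: "'a set" and l r :: "'a \<Rightarrow> 'p::linorder" and y :: "'a \<Rightarrow> 'q::linorder"
    and c :: "'a \<Rightarrow> bool"
  assumes fin: "finite A" and card3: "3 \<le> card A"
    and injl: "inj_on l A" and injr: "inj_on r A"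
    and ne: "\<And>d e. d \<in> A \<Longrightarrow> e \<in> A \<Longrightarrow> l d \<noteq> r e"
    and lr: "\<And>d. d \<in> A \<Longrightarrow> l d < r d"
    and fifo: "\<And>d e. d \<in> A \<Longrightarrow> e \<in> A \<Longrightarrow> l d < l e \<Longrightarrow> r d < r e"
    and yne: "\<And>d e t. d \<in> A \<Longrightarrow> e \<in> A \<Longrightarrow> d \<noteq> e \<Longrightarrow>
      l d \<le> t \<Longrightarrow> t \<le> r d \<Longrightarrow> l e \<le> t \<Longrightarrow> t \<le> r e \<Longrightarrow> y d \<noteq> y e"
  shows "card (\<Union>t. bicolored_neighbours y c {d\<in>A. l d \<le> t \<and> t < r d}) + 4 \<le> 2 * card A"
proof -
  define Q where "Q = l ` A \<union> r ` A"
  \<comment> \<open>\<open>R\<close> is the set of events passed so far: a bar is present once its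
    left end is passed and until its right end is.\<close>
  define F where "F R = bicolored_neighbours y c {d\<in>A. l d \<in> R \<and> r d \<notin> R}" for R
  \<comment> \<open>\<open>T p\<close> includes a bar with an end at \<open>p\<close>, so the same
    set describes the state after an insertion (\<open>step_l\<close>) and the state before a
    removal (\<open>step_r\<close>).\<close>
  define T where "T p = {d\<in>A. l d \<le> p \<and> p \<le> r d}" for p
  define \<delta> where "\<delta> p = card (sym_diff (F {q\<in>Q. q < p}) (F {q\<in>Q. q \<le> p}))" for p
  have finQ: "finite Q" using fin by (simp add: Q_def)
  have lQ: "l d \<in> Q" "r d \<in> Q" if "d \<in> A" for d using that by (auto simp: Q_def)
  have cardQ: "card Q = 2 * card A"
  proof -
    have "card Q = card (l ` A) + card (r ` A)"
      unfolding Q_def using fin ne by (intro card_Un_disjoint) auto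
    then show ?thesis using injl injr by (simp add: card_image)
  qed
  have injlD: "d = e" if "d \<in> A" "e \<in> A" "l d = l e" for d e
    using injl that by (auto dest: inj_onD)
  have injrD: "d = e" if "d \<in> A" "e \<in> A" "r d = r e" for d e
    using injr that by (auto dest: inj_onD)
  have fifo': "r d \<le> r e" if "d \<in> A" "e \<in> A" "l d \<le> l e" for d e
    using that fifo[of d e] injlD[of d e] by (auto simp: order.order_iff_strict)
  have Tinj: "inj_on y (T p)" for p
    using yne unfolding T_def by (intro inj_onI) (metis (mono_tags, lifting) mem_Collect_eq)
  have step_l: "\<delta> (l e) = card (sym_diff (bicolored_neighbours y c (T (l e)))
      (bicolored_neighbours y c (T (l e) - {e})))" if "e \<in> A" for e
  proof -
    have "{d\<in>A. l d \<in> {q\<in>Q. q < l e} \<and> r d \<notin> {q\<in>Q. q < l e}} = T (l e) - {e}"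
      using that lQ injlD by (auto simp: T_def less_le not_less)
    moreover have "{d\<in>A. l d \<in> {q\<in>Q. q \<le> l e} \<and> r d \<notin> {q\<in>Q. q \<le> l e}} = T (l e)"
      using that lQ ne by (auto simp: T_def not_le less_le)
    ultimately show ?thesis by (simp add: \<delta>_def F_def Un_commute)
  qed
  have step_r: "\<delta> (r e) = card (sym_diff (bicolored_neighbours y c (T (r e)))
      (bicolored_neighbours y c (T (r e) - {e})))" if "e \<in> A" for e
  proof -
    have "{d\<in>A. l d \<in> {q\<in>Q. q < r e} \<and> r d \<notin> {q\<in>Q. q < r e}} = T (r e)"
      using that lQ ne by (auto simp: T_def less_le not_less)
    moreover have "{d\<in>A. l d \<in> {q\<in>Q. q \<le> r e} \<and> r d \<notin> {q\<in>Q. q \<le> r e}} = T (r e) - {e}"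
      using that lQ injrD by (auto simp: T_def not_le less_le)
    ultimately show ?thesis by (simp add: \<delta>_def F_def)
  qed
  have TI: "e \<in> T (l e)" "e \<in> T (r e)" if "e \<in> A" for e
    using that lr[of e] by (auto simp: T_def)
  have \<delta>2: "\<delta> p \<le> 2" if "p \<in> Q" for p
    using that bicolored_neighbours_toggle(1)[OF Tinj TI(1)]
      bicolored_neighbours_toggle(1)[OF Tinj TI(2)]
    unfolding Q_def by (auto simp: step_l step_r)
  have \<delta>1l: "\<delta> (l e) \<le> 1"
    if "e \<in> A" "(\<forall>w\<in>T (l e). y e \<le> y w) \<or> (\<forall>w\<in>T (l e). y w \<le> y e)" for e
    using bicolored_neighbours_toggle(2)[OF Tinj TI(1) that(2)] that by (simp add: step_l)
  have \<delta>1r: "\<delta> (r e) \<le> 1"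
    if "e \<in> A" "(\<forall>w\<in>T (r e). y e \<le> y w) \<or> (\<forall>w\<in>T (r e). y w \<le> y e)" for e
    using bicolored_neighbours_toggle(2)[OF Tinj TI(2) that(2)] that by (simp add: step_r)
  have ex_min: "\<exists>b\<in>B. \<forall>d\<in>B. l b \<le> l d" if "B \<subseteq> A" "B \<noteq> {}" for B
  proof -
    have "finite (l ` B)" "l ` B \<noteq> {}" using that fin by (auto intro: finite_subset)
    from Min_in[OF this] obtain b where "b \<in> B" "Min (l ` B) = l b" by auto
    then show ?thesis using Min_le[OF \<open>finite (l ` B)\<close>] by auto
  qed
  have ex_max: "\<exists>b\<in>B. \<forall>d\<in>B. l d \<le> l b" if "B \<subseteq> A" "B \<noteq> {}" for B
  proof -
    have "finite (l ` B)" "l ` B \<noteq> {}" using that fin by (auto intro: finite_subset)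
    from Max_in[OF this] obtain b where "b \<in> B" "Max (l ` B) = l b" by auto
    then show ?thesis using Max_ge[OF \<open>finite (l ` B)\<close>] by auto
  qed
  have not_sub: "\<not> A \<subseteq> {u, v}" for u v
  proof
    assume "A \<subseteq> {u, v}"
    then have "card A \<le> card {u, v}" by (intro card_mono) auto
    also have "\<dots> \<le> 2" by (simp add: card_insert_if)
    finally show False using card3 by simp
  qed
  have "A \<noteq> {}" using card3 by auto
  \<comment> \<open>\<open>b\<close> and \<open>a\<close> are the first two bars inserted,
    \<open>w\<close> and \<open>z\<close> the last two; by \<open>fifo\<close>, \<open>w\<close> and
    \<open>z\<close> are also the last two removed.\<close>
  obtain b where b: "b \<in> A" "\<And>d. d \<in> A \<Longrightarrow> l b \<le> l d"
    using ex_min[OF order.refl \<open>A \<noteq> {}\<close>] by blast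
  obtain z where z: "z \<in> A" "\<And>d. d \<in> A \<Longrightarrow> l d \<le> l z"
    using ex_max[OF order.refl \<open>A \<noteq> {}\<close>] by blast
  obtain a where a: "a \<in> A" "a \<noteq> b" "\<And>d. d \<in> A \<Longrightarrow> d \<noteq> b \<Longrightarrow> l a \<le> l d"
    using ex_min[of "A - {b}"] not_sub[of b b] by (auto simp: subset_iff)
  obtain w where w: "w \<in> A" "w \<noteq> z" "\<And>d. d \<in> A \<Longrightarrow> d \<noteq> z \<Longrightarrow> l d \<le> l w"
    using ex_max[of "A - {z}"] not_sub[of z z] by auto
  have "b \<noteq> w"
  proof
    assume "b = w"
    then have "d = b" if "d \<in> A" "d \<noteq> z" for d
      using that w b injlD[of d b] by (simp add: order.antisym)
    then show False using not_sub[of b z] by auto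
  qed
  have "b \<noteq> z"
    using z(2)[OF a(1)] b(2)[OF a(1)] injlD[OF a(1) b(1)] a(2) by auto
  have 1: "\<delta> (l b) = 0"
  proof -
    have "T (l b) = {b}"
      using b injlD[OF _ b(1)] TI(1)[OF b(1)] by (auto simp: T_def intro: order.antisym)
    then show ?thesis
      using bicolored_neighbours_toggle(3)[OF Tinj TI(1)[OF b(1)]] step_l b by simp
  qed
  have 2: "\<delta> (r z) = 0"
  proof -
    have "T (r z) = {z}"
      using z injrD[OF _ z(1)] fifo'[OF _ z(1)] TI(2)[OF z(1)]
      by (auto simp: T_def intro: order.antisym)
    then show ?thesis
      using bicolored_neighbours_toggle(3)[OF Tinj TI(2)[OF z(1)]] step_r z by simp
  qed
  have 3: "\<delta> (r w) \<le> 1"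
  proof (rule \<delta>1r[OF w(1)])
    \<comment> \<open>Only \<open>z\<close> outlasts \<open>w\<close>, and among at most two bars
      each is extreme in height. The same argument serves for \<open>l a\<close>.\<close>
    have "T (r w) \<subseteq> {w, z}"
      using w(3) injrD[OF _ w(1)] fifo'[OF _ w(1)] by (auto simp: T_def intro: order.antisym)
    then show "(\<forall>u\<in>T (r w). y w \<le> y u) \<or> (\<forall>u\<in>T (r w). y u \<le> y w)"
      using linear[of "y w" "y z"] by auto
  qed
  have 4: "\<delta> (l a) \<le> 1"
  proof (rule \<delta>1l[OF a(1)])
    have "T (l a) \<subseteq> {a, b}"
      using a(3) injlD[OF _ a(1)] by (auto simp: T_def intro: order.antisym)
    then show "(\<forall>u\<in>T (l a). y a \<le> y u) \<or> (\<forall>u\<in>T (l a). y u \<le> y a)"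
      using linear[of "y a" "y b"] by auto
  qed
  \<comment> \<open>Five events may contribute ten in all; a contribution of at most three saves the
    seven.\<close>
  have total: "sum \<delta> Q + 7 \<le> 4 * card A"
    if "X \<subseteq> Q" "card X = 5" "sum \<delta> X \<le> 3" for X
  proof -
    have "sum \<delta> Q = sum \<delta> (Q - X) + sum \<delta> X"
      using that finQ by (intro sum.subset_diff)
    also have "sum \<delta> (Q - X) \<le> (\<Sum>p\<in>Q - X. 2)"
      using \<delta>2 by (intro sum_mono) auto
    also have "\<dots> = 2 * (card Q - 5)"
      using that finQ by (simp add: card_Diff_subset finite_subset)
    finally show ?thesis using that(3) cardQ card3 by simp
  qed
  have "sum \<delta> Q + 7 \<le> 4 * card A"
  proof (cases "(\<forall>u\<in>T (r b). y b \<le> y u) \<or> (\<forall>u\<in>T (r b). y u \<le> y b)")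
    case True
    have dist: "l b \<noteq> r z" "l b \<noteq> l a" "l b \<noteq> r w" "l b \<noteq> r b" "r z \<noteq> l a" "r z \<noteq> r w" "r z \<noteq> r b"
      "l a \<noteq> r w" "l a \<noteq> r b" "r w \<noteq> r b"
      using ne a(1) b(1) z(1) w(1) a(2) w(2) \<open>b \<noteq> w\<close> \<open>b \<noteq> z\<close> injlD injrD by metis+
    have "\<delta> (r b) \<le> 1" using \<delta>1r[OF b(1) True] .
    then show ?thesis using 1 2 3 4 dist
      by (intro total[of "{l b, r z, l a, r w, r b}"]) (auto simp: lQ a b z w)
  next
    case False
    \<comment> \<open>\<open>P\<close> selects a side of \<open>b\<close>, and \<open>g\<close> is
      the first bar inserted on that side among those present at \<open>r b\<close>. A bar present
      at \<open>l g\<close> is still present at \<open>r b\<close>, since \<open>b\<close> enters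
      first and therefore leaves first. So at its insertion \<open>g\<close> is alone on its side of
      \<open>b\<close>, hence extreme.\<close>
    have first: "\<exists>g\<in>A. P (y g) (y b) \<and> \<delta> (l g) \<le> 1"
      if P: "P = (<) \<or> P = (>)" and ex: "\<exists>u\<in>T (r b). P (y u) (y b)" for P :: "'q \<Rightarrow> 'q \<Rightarrow> bool"
    proof -
      obtain g where g: "g \<in> T (r b)" "P (y g) (y b)"
        "\<And>d. d \<in> T (r b) \<Longrightarrow> P (y d) (y b) \<Longrightarrow> l g \<le> l d"
        using ex_min[of "{u\<in>T (r b). P (y u) (y b)}"] ex by (auto simp: T_def)
      have gA: "g \<in> A" "l g \<le> r b" using g(1) by (auto simp: T_def)
      have "d = g \<or> \<not> P (y d) (y b)" if d: "d \<in> T (l g)" for d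
      proof -
        have "d \<in> A" "l d \<le> l g" using d by (auto simp: T_def)
        moreover from this have "d \<in> T (r b)"
          using gA fifo'[OF b(1), of d] b(2)[of d] by (auto simp: T_def)
        ultimately show ?thesis
          using g(3)[of d] injlD[of d g] gA(1) by (auto intro: order.antisym)
      qed
      then have "(\<forall>u\<in>T (l g). y g \<le> y u) \<or> (\<forall>u\<in>T (l g). y u \<le> y g)"
        using P g(2) by (elim disjE) (fastforce simp: not_less)+
      from \<delta>1l[OF gA(1) this] show ?thesis using g(2) gA(1) by blast
    qed
    obtain g where g: "g \<in> A" "y g < y b" "\<delta> (l g) \<le> 1"
      using first[of "(<)"] False by (auto simp: not_le)
    obtain h where h: "h \<in> A" "y h > y b" "\<delta> (l h) \<le> 1"
      using first[of "(>)"] False by (auto simp: not_le)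
    have "g \<noteq> b" "h \<noteq> b" "g \<noteq> h" using g(2) h(2) by auto
    then have dist: "l b \<noteq> r z" "l b \<noteq> l g" "l b \<noteq> r w" "l b \<noteq> l h" "r z \<noteq> l g" "r z \<noteq> r w" "r z \<noteq> l h"
      "l g \<noteq> r w" "l g \<noteq> l h" "r w \<noteq> l h"
      using ne g(1) h(1) b(1) z(1) w(1) w(2) injlD injrD by metis+
    then show ?thesis using 1 2 3 g h
      by (intro total[of "{l b, r z, l g, r w, l h}"]) (auto simp: lQ b z w)
  qed
  \<comment> \<open>All bars are gone after the last event, so the term \<open>card (F Q)\<close>
    vanishes. The even left-hand side is at most \<open>4 * card A - 7\<close>, hence at most
    \<open>4 * card A - 8\<close>.\<close>
  moreover have "2 * card (\<Union>t. F {q\<in>Q. q \<le> t}) \<le> sum \<delta> Q + card (F Q)"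
    unfolding \<delta>_def
    by (intro card_le_sum_sym_diff[OF finQ])
      (auto simp: F_def fin intro: finite_bicolored_neighbours)
  moreover have "F Q = {}" using lQ by (auto simp: F_def bicolored_neighbours_def)
  moreover have "F {q\<in>Q. q \<le> t} = bicolored_neighbours y c {d\<in>A. l d \<le> t \<and> t < r d}" for t
    unfolding F_def by (rule arg_cong[where f = "bicolored_neighbours y c"]) (use lQ in auto)
  ultimately show ?thesis by simp
qed

section \<open>Unit bars and their visible pairs\<close>

text \<open>A bar is encoded by its left end, which turns an arrangement into a set of points that
  the lexicographic order makes linear.\<close>

definition bar_at :: "real \<times> real \<Rightarrow> (real \<times> real) set" where
  "bar_at p = {fst p..fst p + 1} \<times> {snd p}"

lemma unit_bar_iff_bar_at: "unit_bar B \<longleftrightarrow> (\<exists>p. B = bar_at p)"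
  by (auto simp: unit_bar_def bar_at_def)

lemma left_end_in_bar_at [simp]: "p \<in> bar_at p"
  by (simp add: bar_at_def mem_Times_iff)

lemma inj_bar_at: "inj bar_at"
proof (rule injI)
  fix p q assume "bar_at p = bar_at q"
  then have "p \<in> bar_at q" "q \<in> bar_at p" using left_end_in_bar_at by blast+
  then show "p = q" by (auto simp: bar_at_def prod_eq_iff)
qed

text \<open>The four corners of the rectangle lie in the two bars. This fixes its vertical extent by
  their heights and confines its horizontal extent to the common part of their projections.\<close>

lemma sees_from_below_bar_at:
  assumes "sees_from_below \<A> (bar_at p) (bar_at q)"
  obtains a b where "a < b" and "snd p < snd q"
    and "fst p \<le> a" "b \<le> fst p + 1" "fst q \<le> a" "b \<le> fst q + 1"
    and "\<And>D. D \<in> \<A> \<Longrightarrow> ({a<..<b} \<times> {snd p<..<snd q}) \<inter> D = {}"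
proof -
  obtain a b c d where *: "a < b" "c < d" "{a..b} \<times> {c} \<subseteq> bar_at p"
    "{a..b} \<times> {d} \<subseteq> bar_at q" "\<forall>D\<in>\<A>. ({a<..<b} \<times> {c<..<d}) \<inter> D = {}"
    using assms unfolding sees_from_below_def by (elim exE conjE)
  have "(a, c) \<in> bar_at p" "(b, c) \<in> bar_at p"
    using *(1) by (intro subsetD[OF *(3)]; simp)+
  moreover have "(a, d) \<in> bar_at q" "(b, d) \<in> bar_at q"
    using *(1) by (intro subsetD[OF *(4)]; simp)+
  ultimately have cd: "c = snd p" "d = snd q"
    and ab: "fst p \<le> a" "b \<le> fst p + 1" "fst q \<le> a" "b \<le> fst q + 1"
    by (simp_all add: bar_at_def)
  show thesis using *(2,5) unfolding cd by (intro that[OF *(1) _ ab]) (assumption, rule bspec)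
qed

text \<open>
  Sweeping in the lexicographic order of the endpoints amounts to an infinitesimal rotation of the
  sweep line, so no two endpoints are met at the same time.
\<close>

lemma card_visible_bicolored_pairs:
  fixes P :: "(real \<times> real) set" and c :: "real \<times> real \<Rightarrow> bool"
  assumes "finite P" and "3 \<le> card P"
    and disj: "\<And>p q. p \<in> P \<Longrightarrow> q \<in> P \<Longrightarrow> p \<noteq> q \<Longrightarrow> bar_at p \<inter> bar_at q = {}"
  shows "card {(p, q). p \<in> P \<and> q \<in> P \<and> c p \<noteq> c q \<and>
    sees_from_below (bar_at ` P) (bar_at p) (bar_at q)} + 4 \<le> 2 * card P"
proof -
  define r :: "real \<times> real \<Rightarrow> real \<times> real" where "r p = (fst p + 1, snd p)" for p
  let ?S = "\<lambda>t. {p\<in>P. p \<le> t \<and> t < r p}"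
  have sep: "p = q" if "p \<in> P" "q \<in> P" "snd p = snd q" "fst p \<le> x" "x \<le> fst p + 1"
    "fst q \<le> x" "x \<le> fst q + 1" for p q x
  proof (rule ccontr)
    assume "p \<noteq> q"
    moreover have "(x, snd p) \<in> bar_at p \<inter> bar_at q" using that by (auto simp: bar_at_def)
    ultimately show False using disj that by blast
  qed
  have "card (\<Union>t. bicolored_neighbours snd c (?S t)) + 4 \<le> 2 * card P"
  proof (rule card_bicolored_neighbours_sweep[where l = "\<lambda>p. p"])
    show "inj_on r P" by (auto simp: r_def inj_on_def prod_eq_iff)
    show "p \<noteq> r q" if "p \<in> P" "q \<in> P" for p q
      using sep[OF that, of "fst p"] by (auto simp: r_def prod_eq_iff)
    show "p < r p" for p by (simp add: r_def less_prod_def')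
    \<comment> \<open>Equal lengths enter here: \<open>r\<close> is a translation and so preserves
      the lexicographic order.\<close>
    show "r p < r q" if "p < q" for p q using that by (auto simp: r_def less_prod_def')
    show "snd p \<noteq> snd q"
      if "p \<in> P" "q \<in> P" "p \<noteq> q" "p \<le> t" "t \<le> r p" "q \<le> t" "t \<le> r q" for p q t
      using sep[OF that(1,2), of "fst t"] that(3-) by (auto simp: r_def less_eq_prod_def)
    show "finite P" "3 \<le> card P" by (fact assms)+
  qed simp_all
  moreover have "card {(p, q). p \<in> P \<and> q \<in> P \<and> c p \<noteq> c q \<and>
      sees_from_below (bar_at ` P) (bar_at p) (bar_at q)}
    \<le> card (\<Union>t. bicolored_neighbours snd c (?S t))"
  proof (rule card_mono)
    have "(\<Union>t. bicolored_neighbours snd c (?S t)) \<subseteq> P \<times> P"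
      using bicolored_neighbours_subset by blast
    then show "finite (\<Union>t. bicolored_neighbours snd c (?S t))"
      using assms(1) by (meson finite_SigmaI finite_subset)
    have "(p, q) \<in> (\<Union>t. bicolored_neighbours snd c (?S t))"
      if pq: "p \<in> P" "q \<in> P" "c p \<noteq> c q"
        and sees: "sees_from_below (bar_at ` P) (bar_at p) (bar_at q)" for p q
    proof -
      from sees obtain a b where ab: "a < b" "snd p < snd q"
        "fst p \<le> a" "b \<le> fst p + 1" "fst q \<le> a" "b \<le> fst q + 1"
        "\<And>D. D \<in> bar_at ` P \<Longrightarrow> ({a<..<b} \<times> {snd p<..<snd q}) \<inter> D = {}"
        by (rule sees_from_below_bar_at) blast
      \<comment> \<open>The sweep is stopped at \<open>(x, 0)\<close>, where the second coordinate
        is arbitrary: \<open>p\<close> and \<open>q\<close> begin strictly before \<open>x\<close>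
        and end strictly after it. Every bar present there covers \<open>x\<close>, so one of
        intermediate height would meet the interior of the rectangle.\<close>
      define x where "x = (a + b) / 2"
      have x: "a < x" "x < b" using ab(1) by (auto simp: x_def)
      have "\<not> (snd p < snd w \<and> snd w < snd q)" if "w \<in> ?S (x, 0)" for w
      proof
        assume "snd p < snd w \<and> snd w < snd q"
        then have "(x, snd w) \<in> ({a<..<b} \<times> {snd p<..<snd q}) \<inter> bar_at w"
          using that x by (auto simp: bar_at_def r_def less_eq_prod_def less_prod_def')
        then show False using ab(7)[of "bar_at w"] that by blast
      qed
      moreover have "p \<in> ?S (x, 0)" "q \<in> ?S (x, 0)"
        using pq ab x by (auto simp: r_def less_eq_prod_def less_prod_def')
      ultimately have "(p, q) \<in> bicolored_neighbours snd c (?S (x, 0))"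
        using pq(3) ab(2) unfolding bicolored_neighbours_def by blast
      then show ?thesis by blast
    qed
    then show "{(p, q). p \<in> P \<and> q \<in> P \<and> c p \<noteq> c q \<and>
        sees_from_below (bar_at ` P) (bar_at p) (bar_at q)}
      \<subseteq> (\<Union>t. bicolored_neighbours snd c (?S t))" by blast
  qed
  ultimately show ?thesis by linarith
qed

section \<open>Representations of complete bipartite graphs\<close>

text \<open>A bar is colored by the side of the graph that contains its vertex. Each edge needs a
  visible bicolored pair, and different edges need different pairs because a bar has only one
  vertex.\<close>

lemma complete_bipartite_unit_bar_rep_bound:
  assumes rep: "unit_bar_visibility_rep t G f"
    and G: "verts G = U \<union> V" "U \<inter> V = {}" "arcs_ends G = U \<times> V \<union> V \<times> U"
    and UV: "2 \<le> card U" "2 \<le> card V"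
  shows "card U * card V + 4 \<le> 2 * t * (card U + card V)"
proof -
  define \<A> where "\<A> = (\<Union>w\<in>verts G. f w)"
  have fin: "finite U" "finite V" using UV by (auto intro: card_ge_0_finite)
  have f: "finite (f w)" "card (f w) \<le> t" "\<And>B. B \<in> f w \<Longrightarrow> unit_bar B" if "w \<in> verts G" for w
    using rep that by (auto simp: unit_bar_visibility_rep_def)
  have disj: "B \<inter> C = {}"
    if "u \<in> verts G" "v \<in> verts G" "B \<in> f u" "C \<in> f v" "u \<noteq> v \<or> B \<noteq> C" for u v B C
    using rep that by (auto simp: unit_bar_visibility_rep_def)
  have adj: "\<exists>B\<in>f u. \<exists>C\<in>f v. see_each_other \<A> B C" if "u \<in> U" "v \<in> V" for u v
  proof -
    have "u \<in> verts G" "v \<in> verts G" "u \<noteq> v" "u \<rightarrow>\<^bsub>G\<^esub> v" using that G by auto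
    then show ?thesis using rep unfolding unit_bar_visibility_rep_def \<A>_def by blast
  qed
  define P where "P = bar_at -` \<A>"
  have barP: "bar_at ` P = \<A>"
  proof -
    have "\<A> \<subseteq> range bar_at" using f(3) unfolding \<A>_def unit_bar_iff_bar_at by blast
    then show ?thesis by (auto simp: P_def)
  qed
  have fin\<A>: "finite \<A>" using fin f(1) by (auto simp: \<A>_def G)
  have finP: "finite P" using fin\<A> inj_bar_at unfolding P_def by (rule finite_vimageI)
  have "card P = card \<A>"
    using barP inj_bar_at by (metis card_image inj_on_subset subset_UNIV)
  also have "\<dots> \<le> (\<Sum>w\<in>verts G. card (f w))"
    unfolding \<A>_def using fin by (intro card_UN_le) (simp add: G)
  also have "\<dots> \<le> (\<Sum>w\<in>verts G. t)" using f(2) by (rule sum_mono)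
  also have "\<dots> = t * (card U + card V)" using G fin by (simp add: card_Un_disjoint)
  finally have cardP: "card P \<le> t * (card U + card V)" .
  \<comment> \<open>For \<open>p\<close> in \<open>P\<close> the choice is unique: a bar of two
    vertices would be disjoint from itself, yet it contains its left end.\<close>
  define owner where "owner p = (SOME w. w \<in> verts G \<and> bar_at p \<in> f w)" for p
  have owner: "owner p = w" if "w \<in> verts G" "bar_at p \<in> f w" for p w
    unfolding owner_def
  proof (rule some_equality)
    show "w' = w" if "w' \<in> verts G \<and> bar_at p \<in> f w'" for w'
      using disj[of w' w "bar_at p" "bar_at p"] that \<open>w \<in> verts G\<close> \<open>bar_at p \<in> f w\<close>
        left_end_in_bar_at[of p] by blast
  qed (use that in simp)
  have ex_left_end: "\<exists>p\<in>P. bar_at p = B" if "w \<in> verts G" "B \<in> f w" for w B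
    using that f(3)[OF that] by (auto simp: P_def \<A>_def unit_bar_iff_bar_at)
  \<comment> \<open>Every vertex has a neighbour and thus a bar. So there are at least four bars,
    enough for the sweep bound.\<close>
  have "verts G \<subseteq> owner ` P"
  proof
    fix w assume w: "w \<in> verts G"
    have "U \<noteq> {}" "V \<noteq> {}" using UV by auto
    then have "\<exists>B. B \<in> f w" using adj w G(1) by blast
    then obtain B p where "B \<in> f w" "p \<in> P" "bar_at p = B" using ex_left_end[OF w] by blast
    then show "w \<in> owner ` P" using owner[OF w] by blast
  qed
  then have "card (verts G) \<le> card P" using finP by (meson card_image_le card_mono finite_imageI order.trans)
  moreover have "card (verts G) = card U + card V" using G fin by (simp add: card_Un_disjoint)
  ultimately have "3 \<le> card P" using UV by simp
  define E where "E = {(p, q). p \<in> P \<and> q \<in> P \<and> (owner p \<in> U) \<noteq> (owner q \<in> U) \<and>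
    sees_from_below (bar_at ` P) (bar_at p) (bar_at q)}"
  have "card E + 4 \<le> 2 * card P"
    unfolding E_def
  proof (rule card_visible_bicolored_pairs[OF finP \<open>3 \<le> card P\<close>])
    show "bar_at p \<inter> bar_at q = {}" if pq: "p \<in> P" "q \<in> P" "p \<noteq> q" for p q
    proof -
      obtain u v where "u \<in> verts G" "v \<in> verts G" "bar_at p \<in> f u" "bar_at q \<in> f v"
        using pq by (auto simp: P_def \<A>_def)
      moreover have "bar_at p \<noteq> bar_at q" using pq(3) inj_bar_at by (auto dest: injD)
      ultimately show ?thesis using disj by blast
    qed
  qed
  moreover have "card (U \<times> V) \<le> card E"
  proof -
    \<comment> \<open>Pairs in \<open>E\<close> are ordered by height, edges in
      \<open>U \<times> V\<close> by side; \<open>?h\<close> passes from the first order to the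
      second.\<close>
    let ?h = "\<lambda>(p, q). if owner p \<in> U then (owner p, owner q) else (owner q, owner p)"
    have "U \<times> V \<subseteq> ?h ` E"
    proof clarify
      fix u v assume uv: "u \<in> U" "v \<in> V"
      then have uvG: "u \<in> verts G" "v \<in> verts G" "v \<notin> U" using G by auto
      obtain B C where BC: "B \<in> f u" "C \<in> f v" "see_each_other \<A> B C" using adj uv by blast
      obtain p q where p: "p \<in> P" "bar_at p = B" and q: "q \<in> P" "bar_at q = C"
        using ex_left_end BC uvG by meson
      have o: "owner p = u" "owner q = v" using owner p q BC uvG by auto
      have "(p, q) \<in> E \<or> (q, p) \<in> E"
        using BC(3) p q o uv uvG by (auto simp: see_each_other_def E_def barP)
      then show "(u, v) \<in> ?h ` E"
        using o uv uvG by (elim disjE) (force simp: image_iff)+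
    qed
    moreover have "finite E"
      by (rule finite_subset[of _ "P \<times> P"]) (use finP in \<open>auto simp: E_def\<close>)
    ultimately show ?thesis by (meson card_image_le card_mono finite_imageI order.trans)
  qed
  ultimately show ?thesis using cardP by (simp add: card_cartesian_product)
qed

section \<open>Existence of a representation\<close>

text \<open>This ensures that the \<open>LEAST\<close> in the definition of \<open>ub\<close> is
  attained. Each edge receives two stacked bars over an interval of its own.\<close>

lemma complete_bipartite_unit_bar_rep_exists:
  assumes "finite U" "finite V"
    and G: "verts G = U \<union> V" "U \<inter> V = {}" "arcs_ends G = U \<times> V \<union> V \<times> U"
  shows "\<exists>t f. unit_bar_visibility_rep t G f"
proof -
  obtain e :: "'a \<times> 'a \<Rightarrow> nat" where e: "inj_on e (U \<times> V)"
    using finite_imp_inj_to_nat_seg[of "U \<times> V"] assms(1,2) by auto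
  \<comment> \<open>The spacing 3 exceeds the bar length, so bars of different edges have no
    abscissa in common. Height 0 is for the end in \<open>U\<close>, height 1 for the end in
    \<open>V\<close>.\<close>
  define g where "g u v s = bar_at (3 * real (e (u, v)), s)" for u v s
  define f where "f w = (if w \<in> U then (\<lambda>v. g w v 0) ` V else (\<lambda>u. g u w 1) ` U)" for w
  have same: "u = u' \<and> v = v'"
    if "u \<in> U" "v \<in> V" "u' \<in> U" "v' \<in> V" "(x, z) \<in> g u v s" "(x, z') \<in> g u' v' s'"
    for u v u' v' x z z' s s'
  proof -
    have "e (u, v) = e (u', v')" using that by (auto simp: g_def bar_at_def)
    then show ?thesis using e that by (auto dest: inj_onD)
  qed
  have fE: "\<exists>u\<in>U. \<exists>v\<in>V. (w = u \<and> B = g u v 0) \<or> (w = v \<and> w \<notin> U \<and> B = g u v 1)"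
    if "w \<in> verts G" "B \<in> f w" for w B
    using that G by (auto simp: f_def split: if_splits)
  have "unit_bar_visibility_rep (card U + card V) G f"
    unfolding unit_bar_visibility_rep_def
  proof (intro conjI ballI impI)
    fix w assume w: "w \<in> verts G"
    show "finite (f w)" using assms by (simp add: f_def)
    show "card (f w) \<le> card U + card V"
      using assms card_image_le[of V "\<lambda>v. g w v 0"] card_image_le[of U "\<lambda>u. g u w 1"]
      by (simp add: f_def)
    show "unit_bar B" if "B \<in> f w" for B
      using fE[OF w that] by (auto simp: unit_bar_iff_bar_at g_def)
  next
    fix u v B C
    assume uv: "u \<in> verts G" "v \<in> verts G" and BC: "B \<in> f u" "C \<in> f v" and ne: "u \<noteq> v \<or> B \<noteq> C"
    obtain u1 v1 where 1: "u1 \<in> U" "v1 \<in> V"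
      "(u = u1 \<and> B = g u1 v1 0) \<or> (u = v1 \<and> u \<notin> U \<and> B = g u1 v1 1)"
      using fE[OF uv(1) BC(1)] by blast
    obtain u2 v2 where 2: "u2 \<in> U" "v2 \<in> V"
      "(v = u2 \<and> C = g u2 v2 0) \<or> (v = v2 \<and> v \<notin> U \<and> C = g u2 v2 1)"
      using fE[OF uv(2) BC(2)] by blast
    show "B \<inter> C = {}"
    proof (rule ccontr)
      assume "B \<inter> C \<noteq> {}"
      then obtain x z where x: "(x, z) \<in> B" "(x, z) \<in> C" by auto
      then have "u1 = u2 \<and> v1 = v2" using 1 2 same[of u1 v1 u2 v2 x z _ z] by blast
      then show False using 1 2 x ne by (auto simp: g_def bar_at_def)
    qed
  next
    fix u v assume uv: "u \<in> verts G" "v \<in> verts G" and "u \<noteq> v"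
    let ?\<A> = "\<Union>w\<in>verts G. f w"
    have vis: "sees_from_below ?\<A> (g u v 0) (g u v 1)" for u v
      unfolding sees_from_below_def
    proof (intro exI conjI ballI)
      let ?x = "3 * real (e (u, v))"
      show "?x < ?x + 1" "(0::real) < 1" "{?x..?x + 1} \<times> {0} \<subseteq> g u v 0"
        "{?x..?x + 1} \<times> {1} \<subseteq> g u v 1" by (auto simp: g_def bar_at_def)
      show "({?x<..<?x + 1} \<times> {0<..<1}) \<inter> D = {}" if D: "D \<in> ?\<A>" for D
      proof -
        obtain w where "w \<in> verts G" "D \<in> f w" using D by blast
        from fE[OF this] show ?thesis by (auto simp: g_def bar_at_def)
      qed
    qed
    show "u \<rightarrow>\<^bsub>G\<^esub> v \<longleftrightarrow> (\<exists>B\<in>f u. \<exists>C\<in>f v. see_each_other ?\<A> B C)"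
    proof
      assume "u \<rightarrow>\<^bsub>G\<^esub> v"
      then consider "u \<in> U" "v \<in> V" | "u \<in> V" "v \<in> U" using G by auto
      then show "\<exists>B\<in>f u. \<exists>C\<in>f v. see_each_other ?\<A> B C"
      proof cases
        case 1
        then have "g u v 0 \<in> f u" "g u v 1 \<in> f v" using G by (auto simp: f_def)
        then show ?thesis using vis[of u v] unfolding see_each_other_def by blast
      next
        case 2
        then have "g v u 0 \<in> f v" "g v u 1 \<in> f u" using G by (auto simp: f_def)
        then show ?thesis using vis[of v u] unfolding see_each_other_def by blast
      qed
    next
      assume "\<exists>B\<in>f u. \<exists>C\<in>f v. see_each_other ?\<A> B C"
      then obtain B C where BC: "B \<in> f u" "C \<in> f v" "see_each_other ?\<A> B C" by blast
      \<comment> \<open>Bars that see each other share an abscissa; by \<open>same\<close> they then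
        belong to one edge.\<close>
      obtain x z z' where x: "(x, z) \<in> B" "(x, z') \<in> C"
      proof -
        from BC(3) obtain a b c d where "a < b"
          "({a..b} \<times> {c} \<subseteq> B \<and> {a..b} \<times> {d} \<subseteq> C) \<or> ({a..b} \<times> {c} \<subseteq> C \<and> {a..b} \<times> {d} \<subseteq> B)"
          unfolding see_each_other_def sees_from_below_def by blast
        moreover from this have "(a, c) \<in> {a..b} \<times> {c}" "(a, d) \<in> {a..b} \<times> {d}" by simp_all
        ultimately show thesis using that[of a c d] that[of a d c] by blast
      qed
      obtain u1 v1 where 1: "u1 \<in> U" "v1 \<in> V"
        "(u = u1 \<and> B = g u1 v1 0) \<or> (u = v1 \<and> u \<notin> U \<and> B = g u1 v1 1)"
        using fE[OF uv(1) BC(1)] by blast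
      obtain u2 v2 where 2: "u2 \<in> U" "v2 \<in> V"
        "(v = u2 \<and> C = g u2 v2 0) \<or> (v = v2 \<and> v \<notin> U \<and> C = g u2 v2 1)"
        using fE[OF uv(2) BC(2)] by blast
      have "u1 = u2 \<and> v1 = v2" using 1 2 x same[of u1 v1 u2 v2 x z _ z'] by blast
      then show "u \<rightarrow>\<^bsub>G\<^esub> v" using 1 2 \<open>u \<noteq> v\<close> G(3) by auto
    qed
  qed
  then show ?thesis by blast
qed

section \<open>Lower bounds for the unit bar visibility number\<close>

lemma complete_bipartite_ub_bound:
  assumes "K\<^bsub>m,n\<^esub> G" "2 \<le> m" "2 \<le> n"
  shows "m * n + 4 \<le> 2 * ub G * (m + n)"
proof -
  obtain U V where UV: "verts G = U \<union> V" "U \<inter> V = {}" "card U = m" "card V = n"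
    "arcs_ends G = U \<times> V \<union> V \<times> U"
    using assms(1) unfolding complete_bipartite_digraph_def by blast
  have "finite U" "finite V" using UV assms by (auto intro: card_ge_0_finite)
  then have "\<exists>t f. unit_bar_visibility_rep t G f"
    using complete_bipartite_unit_bar_rep_exists UV by blast
  then have "\<exists>f. unit_bar_visibility_rep (ub G) G f"
    unfolding unit_bar_visibility_number_def by (rule LeastI_ex)
  then show ?thesis
    using complete_bipartite_unit_bar_rep_bound[of "ub G" G _ U V] UV assms by auto
qed

text \<open>The left-hand side is \<open>(m * n + 4) / (2 * (m + n))\<close>, split into two
  fractions.\<close>

lemma real_ub_bound:
  assumes "K\<^bsub>m,n\<^esub> G" "2 \<le> m" "2 \<le> n"
  shows "real n / (2 * (real m + real n)) * real m + 2 / (real m + real n) \<le> real (ub G)"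
proof -
  define s where "s = real m + real n"
  have "s > 0" using assms by (simp add: s_def)
  have "real (m * n + 4) \<le> real (2 * ub G * (m + n))"
    using complete_bipartite_ub_bound[OF assms] by (rule of_nat_mono)
  then have "real m * real n + 4 \<le> real (ub G) * (2 * s)"
    by (simp add: s_def algebra_simps)
  then have "(real m * real n + 4) / (2 * s) \<le> real (ub G)"
    using \<open>s > 0\<close> by (simp add: pos_divide_le_eq)
  moreover have "real n / (2 * s) * real m + 2 / s = (real m * real n + 4) / (2 * s)"
    using \<open>s > 0\<close> by (simp add: field_simps)
  ultimately show ?thesis by (simp add: s_def)
qed

theorem theorem21:
  shows "(\<forall>(m::nat) (n::nat) (G :: ('a, 'b) pre_digraph).
            m \<ge> n \<longrightarrow> n \<ge> 2 \<longrightarrow> K\<^bsub>m,n\<^esub> G \<longrightarrow>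
            real (ub G) \<ge> real n / (2 * (real m + real n)) * real m + 2 / (real m + real n))
       \<and> (\<forall>(n :: nat \<Rightarrow> nat) (G :: nat \<Rightarrow> ('a, 'b) pre_digraph).
            (\<forall>\<^sub>F m in at_top. m \<ge> n m \<and> n m \<ge> 2 \<and> K\<^bsub>m,n m\<^esub> (G m)) \<longrightarrow>
            (\<lambda>m. real m - real (n m)) \<in> o(\<lambda>m. real m) \<longrightarrow>
            (\<exists>e :: nat \<Rightarrow> real. e \<in> o(\<lambda>m. real m) \<and>
               (\<forall>\<^sub>F m in at_top. real (ub (G m)) \<ge> real m / 4 + e m)))"
proof (intro conjI allI impI)
  fix m n :: nat and G :: "('a, 'b) pre_digraph"
  assume "m \<ge> n" "n \<ge> 2" "K\<^bsub>m,n\<^esub> G"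
  then show "real (ub G) \<ge> real n / (2 * (real m + real n)) * real m + 2 / (real m + real n)"
    by (intro real_ub_bound) auto
next
  fix n :: "nat \<Rightarrow> nat" and G :: "nat \<Rightarrow> ('a, 'b) pre_digraph"
  assume ev: "\<forall>\<^sub>F m in at_top. m \<ge> n m \<and> n m \<ge> 2 \<and> K\<^bsub>m,n m\<^esub> (G m)"
    and small: "(\<lambda>m. real m - real (n m)) \<in> o(\<lambda>m. real m)"
  \<comment> \<open>This error term turns \<open>m / 4 + e m\<close> into
    \<open>n m / 4\<close>.\<close>
  define e where "e m = (- 1 / 4) * (real m - real (n m))" for m
  have "e \<in> o(\<lambda>m. real m)"
    using small unfolding e_def by (subst landau_o.small.cmult_in_iff) auto
  moreover have "\<forall>\<^sub>F m in at_top. real (ub (G m)) \<ge> real m / 4 + e m"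
    using ev
  proof eventually_elim
    case (elim m)
    have "real m / 4 + e m = real (n m) / 4" by (simp add: e_def field_simps)
    \<comment> \<open>Since \<open>n m \<le> m\<close>, the denominator is at most
      \<open>4 * m\<close>.\<close>
    also have "\<dots> \<le> real (n m) / (2 * (real m + real (n m))) * real m"
    proof -
      have "real (n m) * (real m + real (n m)) \<le> real (n m) * (2 * real m)"
        using elim by (intro mult_left_mono) auto
      moreover have "0 < real m + real (n m)" using elim by simp
      ultimately show ?thesis by (simp add: pos_le_divide_eq algebra_simps)
    qed
    also have "\<dots> \<le> \<dots> + 2 / (real m + real (n m))" by simp
    also have "\<dots> \<le> real (ub (G m))"
      using elim by (intro real_ub_bound) auto
    finally show ?case .
  qed
  ultimately show "\<exists>e :: nat \<Rightarrow> real. e \<in> o(\<lambda>m. real m) \<and>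
      (\<forall>\<^sub>F m in at_top. real (ub (G m)) \<ge> real m / 4 + e m)" by blast
qed

end
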